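(* For integers $n \ge 0$ and $0\le k \le n$, let $X_n$ be a uniformly random binary string of length $n$, let $N_{n,k}$ be the number of distinct subsequences of $X_n$ of length $k$, and let $\hat N_{n,k} = \mathbb{E}[N_{n,k}]$. Then for each fixed integer $m \ge 0$, as $n \to \infty$, \[ \hat N_{n,n-m} = 2^{-m}\binom{n}{m} + O(n^{m-1}). \]
   Context: A subsequence of a string $s = s_0 s_1\cdots s_{n-1}$ is a string $s_{i_1}s_{i_2}\cdots s_{i_k}$ with $0\le i_1<\dots<i_k\le n-1$ (not necessarily contiguous). Subsequences are counted as distinct strings, i.e. different index choices yielding the same string are counted once. *)

theory Defs
  imports
    "HOL-Probability.Probability"
    "HOL-Library.Sublist"
    "HOL-Library.Landau_Symbols"
begin

text \<open>
  \<open>subseq t s\<close> does not require contiguity: by \<open>subseq_conv_nths\<close> it says that \<open>t\<close> is read off \<open>s\<close> along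
  a set of positions. Counting the strings \<open>t\<close> themselves identifies different position
  sets that yield the same string.
\<close>
definition num_subseqs :: "nat \<Rightarrow> 'a list \<Rightarrow> nat" where
  "num_subseqs k s = card {t. subseq t s \<and> length t = k}"

definition random_bitstring :: "nat \<Rightarrow> bool list pmf" where
  "random_bitstring n = pmf_of_set {s. length s = n}"

definition expected_num_subseqs :: "nat \<Rightarrow> nat \<Rightarrow> real" where
  "expected_num_subseqs n k =
     measure_pmf.expectation (random_bitstring n) (\<lambda>s. real (num_subseqs k s))"

text \<open>The side conditions under which \<open>pmf_of_set\<close> is the uniform distribution.\<close>
lemma
  shows finite_bitstrings: "finite {s :: bool list. length s = n}"
    and bitstrings_nonempty: "{s :: bool list. length s = n} \<noteq> {}"
proof -
  show "finite {s :: bool list. length s = n}"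
    using finite_lists_length_eq[of "UNIV :: bool set" n] by simp
  show "{s :: bool list. length s = n} \<noteq> {}"
    using length_replicate[of n True] by blast
qed

end

theory Submission
  imports Defs
begin

text \<open>
  The number of binary strings of length \<open>n\<close> containing a given \<open>t\<close> as a subsequence depends only on
  the length \<open>k\<close> of \<open>t\<close>: comparing first letters gives \<open>F(n+1, k+1) = F(n, k) + F(n, k+1)\<close>, so
  \<open>F(n, k)\<close> is the number of subsets of an \<open>n\<close>-set with at least \<open>k\<close> elements. Double counting the
  pairs \<open>(t, s)\<close> then gives the exact value
  \<open>expected_num_subseqs n (n - m) = 2\<^sup>-\<^sup>m (\<Sum>j\<le>m. n choose j)\<close> for \<open>m \<le> n\<close>, whose top term is the
  claimed main term.
\<close>

lemma card_bitstrings: "card {s :: bool list. length s = n} = 2 ^ n"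
  using card_lists_length_eq[of "UNIV :: bool set" n] by simp

text \<open>Pascal's rule, applied termwise. This is the recurrence for \<open>F\<close> in closed
  form, as the induction on \<open>n\<close> below needs it.\<close>

lemma sum_choose_upper_Suc:
  "(\<Sum>i=Suc k..Suc n. Suc n choose i) = (\<Sum>i=k..n. n choose i) + (\<Sum>i=Suc k..n. n choose i)"
proof -
  have "(\<Sum>i=Suc k..Suc n. Suc n choose i) = (\<Sum>i=k..n. n choose i) + (\<Sum>i=k..n. n choose Suc i)"
    by (simp only: sum.shift_bounds_cl_Suc_ivl binomial_Suc_Suc sum.distrib)
  also have "(\<Sum>i=k..n. n choose Suc i) = (\<Sum>i=Suc k..Suc n. n choose i)"
    by (simp only: sum.shift_bounds_cl_Suc_ivl)
  \<comment> \<open>The extra index \<open>Suc n\<close> contributes \<open>n choose Suc n\<close>,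
    which is 0.\<close>
  also have "\<dots> = (\<Sum>i=Suc k..n. n choose i)"
    by (intro sum.mono_neutral_right) (auto simp: not_le le_Suc_eq)
  finally show ?thesis .
qed

lemma card_superseqs_bool:
  fixes t :: "bool list"
  shows "card {s. length s = n \<and> subseq t s} = (\<Sum>i=length t..n. n choose i)"
proof (induction n arbitrary: t)
  case 0
  have "{s. length s = 0 \<and> subseq t s} = (if t = [] then {[]} else {})"
    by auto
  then show ?case by simp
next
  case (Suc n)
  show ?case
  proof (cases t)
    case Nil
    then show ?thesis
      using choose_row_sum[of "Suc n"] by (simp add: card_bitstrings atMost_atLeast0)
  next
    case (Cons b u)
    let ?A = "{s. length s = n \<and> subseq u s}" and ?B = "{s. length s = n \<and> subseq t s}"
    \<comment> \<open>Greedy matching: a leading \<open>b\<close> may always be matched with the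
      head of \<open>t\<close>, leaving \<open>u\<close> for the tail. The only other letter is
      \<open>\<not> b\<close>, after which the tail must contain all of \<open>t\<close>.\<close>
    have split: "{s. length s = Suc n \<and> subseq t s} = (#) b ` ?A \<union> (#) (\<not> b) ` ?B"
      by (auto simp: Cons length_Suc_conv split: if_splits)
    have fin: "finite {s :: bool list. length s = n \<and> P s}" for P
      by (rule finite_subset[OF _ finite_bitstrings[of n]]) auto
    have "card {s. length s = Suc n \<and> subseq t s} = card ((#) b ` ?A) + card ((#) (\<not> b) ` ?B)"
      unfolding split by (intro card_Un_disjoint finite_imageI fin) auto
    also have "\<dots> = card ?A + card ?B"
      by (simp add: card_image)
    also have "\<dots> = (\<Sum>i=length u..n. n choose i) + (\<Sum>i=Suc (length u)..n. n choose i)"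
      by (simp only: Suc.IH) (simp add: Cons)
    finally show ?thesis
      by (simp only: Cons list.size add_0_right add_Suc_right sum_choose_upper_Suc)
  qed
qed

lemma sum_num_subseqs_bool:
  "(\<Sum>s | length s = n. num_subseqs k (s :: bool list)) = 2 ^ k * (\<Sum>i=k..n. n choose i)"
proof -
  have "(\<Sum>s | length s = n. num_subseqs k (s :: bool list))
      = (\<Sum>s | length s = n. card {t \<in> {t :: bool list. length t = k}. subseq t s})"
    by (intro sum.cong refl) (simp add: num_subseqs_def conj_commute)
  \<comment> \<open>Double counting: every \<open>t\<close> of length \<open>k\<close> lies in
    equally many strings \<open>s\<close>.\<close>
  also have "\<dots> = (\<Sum>t | length (t :: bool list) = k. \<Sum>i=k..n. n choose i)"
    by (rule sum_multicount_gen) (auto simp: finite_bitstrings card_superseqs_bool)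
  finally show ?thesis
    by (simp add: card_bitstrings)
qed

lemma sum_choose_upper_eq_lower:
  assumes "m \<le> n"
  shows "(\<Sum>i=n-m..n. n choose i) = (\<Sum>j\<le>m. n choose j)"
  using assms
  by (intro sum.reindex_bij_witness[of _ "\<lambda>j. n - j" "\<lambda>i. n - i"]) (auto simp: binomial_symmetric[symmetric])

lemma expected_num_subseqs_eq:
  assumes "m \<le> n"
  shows "expected_num_subseqs n (n - m) = (\<Sum>j\<le>m. real (n choose j)) / 2 ^ m"
proof -
  have "expected_num_subseqs n (n - m)
      = real (\<Sum>s | length s = n. num_subseqs (n - m) (s :: bool list)) / 2 ^ n"
    by (simp add: expected_num_subseqs_def random_bitstring_def card_bitstrings
        integral_pmf_of_set[OF bitstrings_nonempty finite_bitstrings])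
  also have "\<dots> = 2 ^ (n - m) * (\<Sum>j\<le>m. real (n choose j)) / 2 ^ n"
    by (simp add: sum_num_subseqs_bool sum_choose_upper_eq_lower[OF assms])
  also have "\<dots> = (\<Sum>j\<le>m. real (n choose j)) / 2 ^ m"
    using assms by (simp add: power_diff)
  finally show ?thesis .
qed

lemma choose_bigo: "(\<lambda>n. real (n choose j)) \<in> O(\<lambda>n. real n ^ j)"
proof (rule bigoI[of _ 1], rule eventually_mono[OF eventually_ge_at_top[of j]])
  fix n assume "j \<le> n"
  then have "real (n choose j) \<le> real (n ^ j)"
    using binomial_le_pow of_nat_le_iff by blast
  then show "norm (real (n choose j)) \<le> 1 * norm (real n ^ j)"
    by simp
qed

theorem theorem2:
  fixes m :: nat
  shows "(\<lambda>n. expected_num_subseqs n (n - m) - real (n choose m) / 2 ^ m)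
           \<in> O(\<lambda>n. real n powi (int m - 1))"
proof -
  \<comment> \<open>Here \<open>j < m\<close> forces \<open>m \<ge> 1\<close>, so the exponent is a
    natural number. For \<open>m = 0\<close> it is -1, but then the sum over \<open>j < m\<close> is
    empty and the error is eventually 0.\<close>
  have "(\<lambda>n. real (n choose j)) \<in> O(\<lambda>n. real n powi (int m - 1))" if "j < m" for j
  proof -
    have "(\<lambda>n. real n ^ j) \<in> O(\<lambda>n. real n ^ (m - 1))"
      using that
      \<comment> \<open>Powers increase with the exponent only for base at least 1;
        \<open>n = 0\<close> can fail, since \<open>0 ^ 0 = 1\<close>.\<close>
      by (intro bigoI[of _ 1] eventually_mono[OF eventually_ge_at_top[of 1]])
        (auto intro!: power_increasing)
    with choose_bigo have "(\<lambda>n. real (n choose j)) \<in> O(\<lambda>n. real n ^ (m - 1))"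
      by (rule landau_o.big_trans)
    moreover have "int m - 1 = int (m - 1)"
      using that by simp
    ultimately show ?thesis
      by (simp only: power_int_of_nat)
  qed
  then have "(\<lambda>n. (\<Sum>j<m. real (n choose j)) / 2 ^ m) \<in> O(\<lambda>n. real n powi (int m - 1))"
    by (auto intro!: big_sum_in_bigo)
  \<comment> \<open>Once \<open>n \<ge> m\<close>, the exact formula applies and its term
    \<open>j = m\<close> cancels the main term.\<close>
  moreover have "\<forall>\<^sub>F n in at_top. expected_num_subseqs n (n - m) - real (n choose m) / 2 ^ m
      = (\<Sum>j<m. real (n choose j)) / 2 ^ m"
    by (rule eventually_mono[OF eventually_ge_at_top[of m]])
      (simp add: expected_num_subseqs_eq lessThan_Suc_atMost[symmetric] add_divide_distrib)
  ultimately show ?thesis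
    by (simp cong: landau_o.big.in_cong)
qed

end
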